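(* Let $\beta=\frac{1+\sqrt5}{2}$. Then $S_\beta(4)=\frac{1}{\beta^4-1}\approx 0.1708$, $S_\beta(6)=\frac{\beta^2+1}{\beta^6-1}\approx 0.2135$, and $$S_\beta(p)=\begin{cases}\dfrac{1-\beta^{2m}}{(\beta^{2m+1}-1)(1-\beta^2)}, & p=2m+1,\ m\in\mathbb N,\\[2mm] \dfrac{1+\beta^{2m+3}-\beta^{2m+2}-\beta^{4m+1}}{(\beta^{4m+2}-1)(1-\beta^2)}, & p=4m+2,\ m\in\mathbb N_{\ge 2},\\[2mm] \dfrac{1+\beta^{2m+3}-\beta^{2m+2}-\beta^{4m+3}}{(\beta^{4m+4}-1)(1-\beta^2)}, & p=4m+4,\ m\in\mathbb N_{\ge 1}.\end{cases}$$ The value of $S_\beta(p)$ is increasing to $\frac{1}{\beta^3-\beta}\approx 0.38212$ as $p$ increases to infinity.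
   Context: Here $\mathbb N=\{0,1,2,\dots\}$ and $\mathbb N_{\ge k}=\{m\in\mathbb N: m\ge k\}$. For $\beta\in(1,2]$ let $T_\beta:[0,1)\to[0,1)$, $T_\beta(x)=\beta x \pmod 1$. For $t\in[0,1)$ the survivor set is $K_\beta(t)=\{x\in[0,1): T_\beta^n(x)\ge t \text{ for all } n\ge 0\}$. A point $x$ has smallest period $p$ if $T_\beta^p(x)=x$ and $T_\beta^j(x)\ne x$ for all $1\le j<p$. For a positive integer $p$, $$S_\beta(p)=\sup\{t\in[0,1): K_\beta(t)\text{ contains a point of smallest period } p\},$$ with the convention that the supremum of the empty set is $0$.
   Formalization: "Increasing" fails over all p (S(3)≈0.3090 > S(4)≈0.1708); proved instead: strictly increasing along odd p and along positive even p, with the whole sequence converging to the limit. The limit is ≈0.38197, so the printed 0.38212 is asserted only within 0.0002. *)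

theory Defs
  imports "HOL-Analysis.Analysis"
begin

text \<open>
  The beta-transformation \<open>x \<mapsto> \<beta> x (mod 1)\<close> is a total function on the reals here; its values lie
  in \<open>[0,1)\<close>, and all points considered below are restricted to that interval explicitly.
\<close>

definition beta_map :: "real \<Rightarrow> real \<Rightarrow> real" where
  "beta_map \<beta> x = frac (\<beta> * x)"

definition survivor_set :: "real \<Rightarrow> real \<Rightarrow> real set" where
  "survivor_set \<beta> t = {x \<in> {0..<1}. \<forall>n. t \<le> (beta_map \<beta> ^^ n) x}"

definition has_smallest_period :: "('a \<Rightarrow> 'a) \<Rightarrow> 'a \<Rightarrow> nat \<Rightarrow> bool" where
  "has_smallest_period f x p \<longleftrightarrow> (f ^^ p) x = x \<and> (\<forall>j. 1 \<le> j \<and> j < p \<longrightarrow> (f ^^ j) x \<noteq> x)"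

definition period_levels :: "real \<Rightarrow> nat \<Rightarrow> real set" where
  "period_levels \<beta> p =
     {t \<in> {0..<1}. \<exists>x \<in> survivor_set \<beta> t. has_smallest_period (beta_map \<beta>) x p}"

text \<open>
  \<open>Sup {}\<close> is unspecified on the reals, so the convention that it is \<open>0\<close> has to be built in.
  Meaningful for \<open>\<beta> \<in> (1,2]\<close> and \<open>p > 0\<close>.
\<close>

definition S_beta :: "real \<Rightarrow> nat \<Rightarrow> real" where
  "S_beta \<beta> p = (if period_levels \<beta> p = {} then 0 else Sup (period_levels \<beta> p))"

end

theory Submission
  imports Defs
begin

text \<open>
  Write \<open>T\<close> for the golden mean map. A periodic orbit meets \<open>survivor_set \<beta> t\<close> exactly when its
  least point is at least \<open>t\<close>, so \<open>S_beta \<beta> p\<close> is the largest least point among the orbits of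
  smallest period \<open>p\<close>.

  Because \<open>\<beta>\<^sup>2 = \<beta> + 1\<close>, the digit \<open>1\<close> is always followed by \<open>0\<close>, and after the first digit
  \<open>0\<close> the expansion splits into the words \<open>0\<close> and \<open>01\<close>. Here \<open>\<beta> - 1 = 1/\<beta>\<close> and
  \<open>2 - \<beta> = 1/\<beta>\<^sup>2\<close>. Points below \<open>2 - \<beta>\<close> are those whose expansion begins with \<open>00\<close> (their
  image is again below \<open>\<beta> - 1\<close>), and such a point reads a block \<open>0(01)\<^sup>k\<close> before it returns below
  \<open>2 - \<beta>\<close>. The return takes the odd time \<open>2 k + 1\<close> and is given by the increasing affine map
  \<open>block k\<close> (lemma \<open>block_orbit\<close>); a larger starting point never has a smaller index \<open>k\<close>. The
  least point of an orbit is always below \<open>2 - \<beta>\<close>.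

  For \<open>p = 2 m + 1\<close> the extremal orbit consists of a single block, with index \<open>m\<close>. If the least
  point \<open>x\<close> of an orbit lies strictly above the fixed point \<open>s\<close> of \<open>block m\<close>, then
  \<open>block m x \<ge> 0\<close>, so the \<open>p\<close>-th iterate of \<open>T\<close> acts on \<open>x\<close> as \<open>block m\<close>. This map expands about
  \<open>s\<close>, so \<open>x\<close> cannot have period \<open>p\<close>.

  For even \<open>p\<close> an orbit has an even number of blocks, hence at least two. If \<open>k\<close> is the index of
  its least point, then all its indices are at least \<open>k\<close>, whence \<open>p \<ge> 2 (2 k + 1)\<close>; equality would
  mean two equal blocks, that is, the smaller period \<open>2 k + 1\<close>. So \<open>4 k + 4 \<le> p\<close>
  (lemma \<open>even_period_return_index\<close>). The extremal orbit has two blocks with indices \<open>a < b\<close>, as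
  equal as \<open>2 a + 2 b + 2 = p\<close> permits: \<open>b = a + 1\<close> or \<open>b = a + 2\<close>. An orbit whose least point
  exceeds the extremal one has first index at least \<open>a\<close> by monotonicity and at most \<open>a\<close> by the
  bound, and then the expansion argument applies to \<open>block b \<circ> block a\<close> (theorem
  \<open>S_beta_even\<close>).

  Monotonicity and the limit are read off from closed forms \<open>(2 - \<beta>) (1 - d)\<close>, in which the
  defect \<open>d\<close> decreases and is of the order of \<open>\<beta> ^ (- p)\<close> for odd and \<open>\<beta> ^ (- p/2)\<close> for even
  \<open>p\<close>.
\<close>

section \<open>Least points of periodic orbits\<close>

lemma smallest_period_funpow:
  assumes "has_smallest_period f x p" "i < p"
  shows "has_smallest_period f ((f ^^ i) x) p"
proof -
  have per: "(f ^^ p) x = x" and least: "\<And>j. 1 \<le> j \<Longrightarrow> j < p \<Longrightarrow> (f ^^ j) x \<noteq> x"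
    using assms(1) by (auto simp: has_smallest_period_def)
  have return: "(f ^^ (p - i)) ((f ^^ i) x) = x"
    using per assms(2) by (simp flip: comp_apply[of "f ^^ (p - i)"] funpow_add)
  have comm: "(f ^^ j) ((f ^^ l) z) = (f ^^ l) ((f ^^ j) z)" for j l z
    by (simp add: add.commute flip: comp_apply[of "f ^^ _"] funpow_add)
  show ?thesis
    unfolding has_smallest_period_def
    using per least return comm by metis
qed

lemma periodic_orbit_has_least_point:
  fixes f :: "'a::linorder \<Rightarrow> 'a"
  assumes "has_smallest_period f x p" "0 < p"
  obtains i where "has_smallest_period f ((f ^^ i) x) p"
    and "\<And>n. (f ^^ i) x \<le> (f ^^ n) ((f ^^ i) x)"
proof -
  let ?O = "(\<lambda>i. (f ^^ i) x) ` {..<p}"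
  have "Min ?O \<in> ?O"
    using assms(2) by (intro Min_in) auto
  then obtain i where i: "i < p" "(f ^^ i) x = Min ?O"
    by auto
  have "(f ^^ i) x \<le> (f ^^ n) ((f ^^ i) x)" for n
  proof -
    have "(f ^^ n) ((f ^^ i) x) = (f ^^ ((n + i) mod p)) x"
      using assms(1) by (simp add: funpow_mod_eq has_smallest_period_def funpow_add)
    then show ?thesis
      using i(2) assms(2) by simp
  qed
  then show thesis
    by (rule that[OF smallest_period_funpow[OF assms(1) i(1)]])
qed

text \<open>
  The form in which the extremal orbits are verified: showing that the orbit stays strictly above
  \<open>s\<close> before time \<open>p\<close> yields at once that \<open>p\<close> is the smallest period and that \<open>s\<close> is the
  least point.
\<close>
lemma cycle_above_base_point:
  fixes f :: "'a::linorder \<Rightarrow> 'a"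
  assumes "(f ^^ p) s = s" "0 < p" "\<And>j. 0 < j \<Longrightarrow> j < p \<Longrightarrow> s < (f ^^ j) s"
  shows "has_smallest_period f s p" "s \<le> (f ^^ n) s"
proof -
  show "has_smallest_period f s p"
    unfolding has_smallest_period_def
    using assms(1) less_imp_neq[OF assms(3)] by (metis One_nat_def Suc_le_eq)
  have "s \<le> (f ^^ (n mod p)) s"
    using assms(2) assms(3)[of "n mod p"] by (cases "n mod p = 0") auto
  then show "s \<le> (f ^^ n) s"
    by (simp add: funpow_mod_eq[OF assms(1)])
qed

lemma period_level_least_point:
  assumes t: "t \<in> period_levels \<beta> p" and "0 < p"
  obtains x where "t \<le> x" "0 \<le> x" "x < 1" "has_smallest_period (beta_map \<beta>) x p"
    "\<And>n. x \<le> (beta_map \<beta> ^^ n) x"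
proof -
  obtain z where z: "z \<in> {0..<1}" "\<And>n. t \<le> (beta_map \<beta> ^^ n) z"
      "has_smallest_period (beta_map \<beta>) z p"
    using t unfolding period_levels_def survivor_set_def by blast
  obtain i where i: "has_smallest_period (beta_map \<beta>) ((beta_map \<beta> ^^ i) z) p"
      "\<And>n. (beta_map \<beta> ^^ i) z \<le> (beta_map \<beta> ^^ n) ((beta_map \<beta> ^^ i) z)"
    using periodic_orbit_has_least_point[OF z(3) \<open>0 < p\<close>] by blast
  have "(beta_map \<beta> ^^ i) z \<in> {0..<1}"
    using z(1) by (cases i) (auto simp: beta_map_def frac_lt_1)
  then show thesis
    using that[OF z(2)[of i] _ _ i] by simp
qed

text \<open>
  Since a periodic orbit survives exactly the levels up to its least point, \<open>S_beta \<beta> p\<close> is the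
  largest least point of an orbit of smallest period \<open>p\<close>, as soon as one such orbit is known to be
  extremal.
\<close>
lemma S_beta_eqI:
  assumes "0 \<le> s" "s < 1" "has_smallest_period (beta_map \<beta>) s p" "0 < p"
    and "\<And>n. s \<le> (beta_map \<beta> ^^ n) s"
    and upper: "\<And>x. \<lbrakk>0 \<le> x; x < 1; has_smallest_period (beta_map \<beta>) x p;
                  \<And>n. x \<le> (beta_map \<beta> ^^ n) x\<rbrakk> \<Longrightarrow> x \<le> s"
  shows "S_beta \<beta> p = s"
proof -
  have mem: "s \<in> period_levels \<beta> p"
    using assms by (auto simp: period_levels_def survivor_set_def)
  have "t \<le> s" if t: "t \<in> period_levels \<beta> p" for t
    using period_level_least_point[OF t \<open>0 < p\<close>] upper order_trans by metis
  then show ?thesis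
    using mem cSup_eq_maximum[OF mem] by (auto simp: S_beta_def)
qed

section \<open>The golden mean map and its blocks\<close>

locale golden_mean =
  fixes \<beta> :: real
  assumes golden: "\<beta> = (1 + sqrt 5) / 2"
begin

abbreviation T :: "real \<Rightarrow> real" where "T \<equiv> beta_map \<beta>"

lemma beta_square: "\<beta> ^ 2 = \<beta> + 1"
  by (simp add: golden power2_eq_square field_simps)

lemma beta_times_beta: "\<beta> * \<beta> = \<beta> + 1"
  using beta_square by (simp add: power2_eq_square)

lemma beta_times_beta_left: "\<beta> * (\<beta> * x) = \<beta> * x + x"
  using beta_times_beta by (simp add: distrib_right flip: mult.assoc)

text \<open>
  Reducing \<open>\<beta> * \<beta>\<close> to \<open>\<beta> + 1\<close> after expansion leaves at most one factor \<open>\<beta>\<close> in each monomial, which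
  decides polynomial identities in \<open>\<beta>\<close>.
\<close>
lemmas beta_simps = algebra_simps beta_times_beta beta_times_beta_left

lemma beta_bounds: "161803 / 100000 < \<beta>" "\<beta> < 1618035 / 1000000"
proof -
  have "223606 / 100000 < sqrt 5" "sqrt 5 < 223607 / 100000"
    by (rule real_less_rsqrt real_less_lsqrt; simp add: power2_eq_square)+
  then show "161803 / 100000 < \<beta>" "\<beta> < 1618035 / 1000000"
    by (simp_all add: golden)
qed

lemma beta_gt_1: "1 < \<beta>"
  using beta_bounds by simp

lemma one_le_beta_power: "1 \<le> \<beta> ^ n"
  using beta_gt_1 by simp

lemma T_below:
  assumes "0 \<le> x" "x < \<beta> - 1"
  shows "T x = \<beta> * x"
proof -
  have "\<beta> * x < \<beta> * (\<beta> - 1)"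
    using assms beta_gt_1 by (intro mult_strict_left_mono) auto
  then show ?thesis
    using assms beta_gt_1 by (simp add: beta_map_def frac_eq beta_simps)
qed

lemma T_above:
  assumes "\<beta> - 1 \<le> x" "x < 1"
  shows "T x = \<beta> * x - 1"
proof -
  have "\<beta> * (\<beta> - 1) \<le> \<beta> * x"
    using assms beta_gt_1 by (intro mult_left_mono) auto
  moreover have "\<beta> * x < 2 * 1"
    using assms beta_bounds by (intro mult_strict_mono') auto
  ultimately show ?thesis
    unfolding beta_map_def frac_unique_iff by (simp add: beta_simps)
qed

text \<open>The branch belonging to the digits \<open>01\<close>; it maps its interval onto all of \<open>[0, \<beta> - 1)\<close>.\<close>
lemma T_twice:
  assumes "2 - \<beta> \<le> x" "x < \<beta> - 1"
  shows "T x = \<beta> * x" "\<beta> - 1 \<le> \<beta> * x" "T (T x) = \<beta> ^ 2 * x - 1"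
proof -
  show T: "T x = \<beta> * x"
    using assms beta_bounds by (intro T_below) auto
  have "\<beta> * (2 - \<beta>) \<le> \<beta> * x" "\<beta> * x < \<beta> * (\<beta> - 1)"
    using assms beta_gt_1 by (auto intro!: mult_left_mono mult_strict_left_mono)
  then have "\<beta> - 1 \<le> \<beta> * x \<and> \<beta> * x < 1"
    by (simp add: beta_simps)
  then show "\<beta> - 1 \<le> \<beta> * x" "T (T x) = \<beta> ^ 2 * x - 1"
    using T T_above by (auto simp: power2_eq_square)
qed

text \<open>
  The branch of \<open>T\<close> iterated \<open>2 k + 1\<close> times on the points whose digits begin with \<open>0(01)\<^sup>k\<close>. After
  the digit \<open>0\<close>, which multiplies by \<open>\<beta>\<close>, every word \<open>01\<close> acts by \<open>x \<mapsto> \<beta>\<^sup>2 x - 1\<close>, with fixed point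
  \<open>\<beta> - 1\<close>; the formula scales the distance to this fixed point by \<open>\<beta>\<^sup>2\<close> per word.
\<close>
definition block :: "nat \<Rightarrow> real \<Rightarrow> real" where
  "block k y = (\<beta> - 1) - \<beta> ^ (2 * k) * ((\<beta> - 1) - \<beta> * y)"

lemma block_0: "block 0 y = \<beta> * y"
  by (simp add: block_def)

lemma block_Suc: "block (Suc k) y = \<beta> ^ 2 * block k y - 1"
  by (simp add: block_def power_add power2_eq_square beta_simps)

lemma block_diff: "block k y - block k z = \<beta> ^ (2 * k + 1) * (y - z)"
  by (simp add: block_def algebra_simps)

lemma block_mono: "y \<le> z \<Longrightarrow> block k y \<le> block k z"
  and block_strict_mono: "y < z \<Longrightarrow> block k y < block k z"
  using beta_gt_1 by (simp_all add: block_def)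

lemma block_less:
  assumes "y < 2 - \<beta>"
  shows "block k y < \<beta> - 1"
proof -
  have "\<beta> * y < \<beta> * (2 - \<beta>)"
    using assms beta_gt_1 by (intro mult_strict_left_mono) auto
  then have "0 < (\<beta> - 1) - \<beta> * y"
    by (simp add: beta_simps)
  then show ?thesis
    using beta_gt_1 by (simp add: block_def)
qed

text \<open>
  Nonnegativity of \<open>block k y\<close> alone guarantees that \<open>y\<close> reads \<open>0(01)\<^sup>k\<close>: by \<open>block_Suc\<close>, a
  nonnegative value of \<open>block (Suc k) y\<close> forces \<open>block k y \<ge> 1/\<beta>\<^sup>2 = 2 - \<beta>\<close>, which is the
  condition for reading another word \<open>01\<close>. The same inequality keeps the orbit above \<open>2 - \<beta>\<close>
  meanwhile.
\<close>
lemma block_orbit: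
  assumes "0 \<le> y" "y < 2 - \<beta>" "0 \<le> block k y"
  shows "(T ^^ (2 * k + 1)) y = block k y \<and> (\<forall>j. 0 < j \<and> j < 2 * k + 1 \<longrightarrow> 2 - \<beta> \<le> (T ^^ j) y)"
  using assms(3)
proof (induction k)
  case 0
  then show ?case
    using assms beta_bounds by (simp add: block_0 T_below)
next
  case (Suc k)
  let ?z = "block k y"
  have "1 \<le> \<beta> ^ 2 * ?z"
    using Suc.prems by (simp add: block_Suc)
  then have "(2 - \<beta>) * 1 \<le> (2 - \<beta>) * (\<beta> ^ 2 * ?z)"
    using beta_bounds by (intro mult_left_mono) auto
  then have z: "2 - \<beta> \<le> ?z"
    by (simp add: power2_eq_square beta_simps)
  have IH: "(T ^^ (2 * k + 1)) y = ?z" "\<And>j. 0 < j \<Longrightarrow> j < 2 * k + 1 \<Longrightarrow> 2 - \<beta> \<le> (T ^^ j) y"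
    using Suc.IH z beta_bounds by auto
  note sq = T_twice[OF z block_less[OF assms(2)]]
  have T2: "(T ^^ (2 * k + 2)) y = T ?z"
    using IH(1) by simp
  have "(T ^^ (2 * Suc k + 1)) y = T (T ?z)"
    using IH(1) by simp
  moreover have "2 - \<beta> \<le> (T ^^ j) y" if "0 < j" and j: "j < 2 * Suc k + 1" for j
  proof -
    have "j < 2 * k + 1 \<or> j = 2 * k + 1 \<or> j = 2 * k + 2"
      using j by auto
    then consider "j < 2 * k + 1" | "j = 2 * k + 1" | "j = 2 * k + 2"
      by blast
    then show ?thesis
    proof cases
      case 1
      then show ?thesis using IH(2) \<open>0 < j\<close> by blast
    next
      case 2
      then show ?thesis using IH(1) z by simp
    next
      case 3
      then have "(T ^^ j) y = \<beta> * ?z"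
        using T2 sq(1) by simp
      then show ?thesis
        using sq(2) beta_bounds by linarith
    qed
  qed
  ultimately show ?case
    using sq(3) by (simp add: block_Suc)
qed

lemmas block_funpow = block_orbit[THEN conjunct1]
lemmas block_between = block_orbit[THEN conjunct2, rule_format, OF _ _ _ conjI]

text \<open>
  A point above \<open>2 - \<beta>\<close> moves down: after one step if it is at least \<open>\<beta> - 1\<close>, and otherwise
  after two, because \<open>x \<mapsto> \<beta>\<^sup>2 x - 1\<close> pushes it away from its fixed point \<open>\<beta> - 1\<close>.
\<close>
lemma least_point_less:
  assumes "0 \<le> x" "x < 1" and least: "\<And>n. x \<le> (T ^^ n) x"
  shows "x < 2 - \<beta>"
proof (rule ccontr)
  assume "\<not> x < 2 - \<beta>"
  then have ge: "2 - \<beta> \<le> x" by simp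
  have less: "x < \<beta> - 1"
  proof (rule ccontr)
    assume "\<not> x < \<beta> - 1"
    then have "x \<le> \<beta> * x - 1"
      using least[of 1] T_above assms by simp
    then have "0 \<le> (\<beta> - 1) * x - 1"
      by (simp add: algebra_simps)
    moreover have "(\<beta> - 1) * x < 1 * 1"
      using assms beta_bounds by (intro mult_strict_mono') auto
    ultimately show False by simp
  qed
  have "x \<le> \<beta> ^ 2 * x - 1"
    using least[of 2] T_twice(3)[OF ge less] by (simp add: numeral_2_eq_2)
  then have "(\<beta> - 1) * 1 \<le> (\<beta> - 1) * (\<beta> * x)"
    using beta_gt_1 by (intro mult_left_mono) (auto simp: beta_square algebra_simps)
  then show False
    using less by (simp add: beta_simps)
qed

text \<open>
  A value of \<open>block k y\<close> below \<open>2 - \<beta>\<close> means that no word \<open>01\<close> follows the block, so that \<open>k\<close> is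
  the largest index with \<open>block k y \<ge> 0\<close>.
\<close>
lemma block_index_le:
  assumes "y < 2 - \<beta>" "0 \<le> block i y" "block k y < 2 - \<beta>"
  shows "i \<le> k"
proof (rule ccontr)
  assume "\<not> i \<le> k"
  then have le: "Suc k \<le> i" by simp
  have "0 < \<beta> - 1 - \<beta> * y"
    using block_less[OF assms(1), of 0] by (simp add: block_0)
  then have "block i y \<le> block (Suc k) y"
    unfolding block_def using le beta_gt_1
    by (intro diff_left_mono mult_right_mono power_increasing) auto
  moreover have "\<beta> ^ 2 * block k y < \<beta> ^ 2 * (2 - \<beta>)"
    using assms(3) beta_gt_1 by (intro mult_strict_left_mono) auto
  then have "block (Suc k) y < 0"
    by (simp add: block_Suc power2_eq_square beta_simps)
  ultimately show False
    using assms(2) by linarith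
qed

text \<open>
  The index is finite because a periodic orbit has to come back to \<open>x\<close>, which lies below \<open>2 - \<beta>\<close>,
  by time \<open>p\<close>.
\<close>
lemma return_index:
  assumes "0 \<le> x" "x < 2 - \<beta>" "(T ^^ p) x = x" "0 < p"
  obtains k where "0 \<le> block k x" "block k x < 2 - \<beta>"
proof -
  \<comment> \<open>otherwise the orbit would stay above \<open>2 - \<beta>\<close> until time \<open>2 p + 1\<close>\<close>
  have "block p x < 0"
    using block_between[OF assms(1,2), of p p] assms by force
  then have ex: "\<exists>i. block i x < 0" ..
  define i where "i = (LEAST i. block i x < 0)"
  have neg: "block i x < 0"
    unfolding i_def using ex by (rule LeastI_ex)
  have "0 \<le> block 0 x"
    using assms beta_gt_1 by (simp add: block_0)
  with neg obtain k where k: "i = Suc k"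
    by (cases i) auto
  then have nonneg: "0 \<le> block k x"
    using not_less_Least[of k "\<lambda>i. block i x < 0"] by (auto simp: i_def)
  have "\<beta> ^ 2 * block k x < 1"
    using neg k by (simp add: block_Suc)
  then have "(2 - \<beta>) * (\<beta> ^ 2 * block k x) < (2 - \<beta>) * 1"
    using beta_bounds by (intro mult_strict_left_mono) auto
  then have "block k x < 2 - \<beta>"
    by (simp add: power2_eq_square beta_simps)
  with nonneg show thesis
    by (rule that)
qed

section \<open>The extremal orbits\<close>

text \<open>
  The first return of \<open>x\<close> below \<open>2 - \<beta>\<close> happens at an odd time, so an even period leaves room for
  a second block. That block starts at a point \<open>y \<ge> x\<close> and so is no shorter than the first. If it
  also ends at time \<open>p\<close> with the same index, then one increasing affine map exchanges \<open>x\<close> and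
  \<open>y\<close>, which forces \<open>x = y\<close> and contradicts minimality of \<open>p\<close>. Parity of the remaining time
  \<open>q\<close> then gains another two steps.
\<close>
lemma even_period_return_index:
  assumes "0 \<le> x" "x < 2 - \<beta>" "has_smallest_period T x p" "even p" "0 < p"
    and least: "\<And>n. x \<le> (T ^^ n) x"
    and k: "0 \<le> block k x" "block k x < 2 - \<beta>"
  shows "4 * k + 4 \<le> p"
proof -
  define y where "y = block k x"
  have per: "(T ^^ p) x = x" and minimal: "\<And>j. 1 \<le> j \<Longrightarrow> j < p \<Longrightarrow> (T ^^ j) x \<noteq> x"
    using assms(3) by (auto simp: has_smallest_period_def)
  have y: "(T ^^ (2 * k + 1)) x = y" "0 \<le> y" "y < 2 - \<beta>"
    using block_funpow[OF assms(1,2) k(1)] k by (auto simp: y_def)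
  have "x \<le> y"
    using least[of "2 * k + 1"] y(1) by simp
  then have ky: "0 \<le> block k y"
    using k(1) block_mono[of x y k] by linarith
  have "\<not> p < 2 * k + 1"
    using block_between[OF assms(1,2) k(1), of p] per assms by force
  moreover have "p \<noteq> 2 * k + 1"
    using \<open>even p\<close> by auto
  ultimately obtain q where q: "p = q + (2 * k + 1)" "0 < q"
    by (metis add.commute less_imp_add_positive linorder_neqE_nat)
  then have Tq: "(T ^^ q) y = x"
    using per y(1) by (metis comp_apply funpow_add)
  have "\<not> q < 2 * k + 1"
    using block_between[OF y(2,3) ky, of q] Tq q(2) assms by force
  moreover have "q \<noteq> 2 * k + 1"
  proof
    assume eq: "q = 2 * k + 1"
    then have "block k y = x"
      using block_funpow[OF y(2,3) ky] Tq by simp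
    then have "x - y = \<beta> ^ (2 * k + 1) * (y - x)"
      using block_diff[of k y x] by (simp add: y_def)
    then have "(1 + \<beta> ^ (2 * k + 1)) * (y - x) = 0"
      by (simp add: algebra_simps)
    then have "y = x"
      using one_le_beta_power[of "2 * k + 1"] by simp
    then show False
      using minimal[of "2 * k + 1"] y(1) q eq by simp
  qed
  moreover have "odd q"
    using \<open>even p\<close> q(1) by simp
  ultimately have "2 * k + 3 \<le> q"
    by presburger
  then show ?thesis
    using q(1) by simp
qed

text \<open>The fixed point of \<open>block m\<close>: the point with periodic digits \<open>0(01)\<^sup>m\<close>.\<close>
definition odd_point :: "nat \<Rightarrow> real" where
  "odd_point m = (\<beta> - 1) * (\<beta> ^ (2 * m) - 1) / (\<beta> ^ (2 * m + 1) - 1)"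

lemma block_odd_point: "block m (odd_point m) = odd_point m"
proof -
  define q where "q = \<beta> ^ (2 * m)"
  have "1 < \<beta> ^ (2 * m + 1)"
    using beta_gt_1 by (intro one_less_power) auto
  then have "\<beta> * q \<noteq> 1"
    by (simp add: q_def)
  then show ?thesis
    by (simp add: block_def odd_point_def q_def[symmetric] divide_simps) (simp add: beta_simps)
qed

lemma odd_point_bounds: "0 \<le> odd_point m" "odd_point m < 2 - \<beta>"
proof -
  have q: "1 \<le> \<beta> ^ (2 * m)" "1 < \<beta> ^ (2 * m + 1)"
    using beta_gt_1 by (auto intro: one_less_power simp del: power_Suc)
  show "0 \<le> odd_point m"
    unfolding odd_point_def using q beta_gt_1 by simp
  show "odd_point m < 2 - \<beta>"
    using q beta_bounds by (simp add: odd_point_def divide_simps) (simp add: beta_simps)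
qed

text \<open>
  An orbit of period \<open>2 m + 1\<close> with least point above the fixed point of \<open>block m\<close> would be carried
  to itself by \<open>block m\<close>, which strictly expands the distance to that fixed point.
\<close>
theorem S_beta_odd: "S_beta \<beta> (2 * m + 1) = odd_point m"
proof -
  let ?s = "odd_point m"
  note s = odd_point_bounds[of m]
  have nonneg: "0 \<le> block m ?s"
    using s by (simp add: block_odd_point)
  have cycle: "(T ^^ (2 * m + 1)) ?s = ?s"
    using block_funpow[OF s nonneg] by (simp add: block_odd_point)
  have above: "?s < (T ^^ j) ?s" if "0 < j" "j < 2 * m + 1" for j
    using block_between[OF s nonneg that] s by linarith
  show ?thesis
  proof (rule S_beta_eqI)
    show "0 \<le> ?s" "?s < 1" using s beta_gt_1 by auto
    show "has_smallest_period T ?s (2 * m + 1)" "\<And>n. ?s \<le> (T ^^ n) ?s"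
      using cycle_above_base_point[OF cycle _ above] by auto
  next
    fix x assume x: "0 \<le> x" "x < 1" "has_smallest_period T x (2 * m + 1)" "\<And>n. x \<le> (T ^^ n) x"
    show "x \<le> ?s"
    proof (rule ccontr)
      assume "\<not> x \<le> ?s"
      then have gt: "?s < x" by simp
      then have "0 \<le> block m x"
        using block_strict_mono[OF gt, of m] nonneg by linarith
      then have "block m x = x"
        using block_funpow[OF x(1) least_point_less[OF x(1,2,4)]] x(3)
        by (simp add: has_smallest_period_def)
      then have "x - ?s = \<beta> ^ (2 * m + 1) * (x - ?s)"
        using block_diff[of m x ?s] by (simp add: block_odd_point)
      then have "\<beta> ^ (2 * m + 1) = 1"
        using gt by simp
      moreover have "1 < \<beta> ^ (2 * m + 1)"
        using beta_gt_1 by (intro one_less_power) auto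
      ultimately show False
        by simp
    qed
  qed simp
qed

text \<open>
  The fixed point of \<open>block b \<circ> block a\<close>: the point with periodic digits
  \<open>0(01)\<^sup>a0(01)\<^sup>b\<close>. By symmetry, its image under \<open>block a\<close> is the same expression with \<open>a\<close> and
  \<open>b\<close> exchanged.
\<close>
definition even_point :: "nat \<Rightarrow> nat \<Rightarrow> real" where
  "even_point a b = (\<beta> - 1) * (\<beta> ^ (2 * a + 2 * b + 1) - \<beta> ^ (2 * b + 1) + \<beta> ^ (2 * b) - 1)
                    / (\<beta> ^ (2 * a + 2 * b + 2) - 1)"

lemma block_even_point: "block a (even_point a b) = even_point b a"
proof -
  define A B where "A = \<beta> ^ (2 * a)" and "B = \<beta> ^ (2 * b)"
  have "1 < \<beta> ^ (2 * a + 2 * b + 2)"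
    using beta_gt_1 by (intro one_less_power) auto
  then have ne: "\<beta> ^ 2 * A * B - 1 \<noteq> 0"
    by (simp add: A_def B_def power_add power2_eq_square mult_ac)
  have a: "even_point a b = (\<beta> - 1) * (\<beta> * A * B - \<beta> * B + B - 1) / (\<beta> ^ 2 * A * B - 1)"
    and b: "even_point b a = (\<beta> - 1) * (\<beta> * A * B - \<beta> * A + A - 1) / (\<beta> ^ 2 * A * B - 1)"
    unfolding even_point_def A_def B_def power_add by (simp_all add: mult_ac)
  show ?thesis
    unfolding a b block_def A_def[symmetric] using ne
    by (simp add: divide_simps) (simp add: power2_eq_square beta_simps)
qed

lemma even_point_bounds:
  assumes "a < b"
  shows "0 \<le> even_point a b" "even_point a b < even_point b a" "even_point b a < 2 - \<beta>"
proof -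
  define A B where "A = \<beta> ^ (2 * a)" and "B = \<beta> ^ (2 * b)"
  have A: "1 \<le> A" and AB: "A < B"
    using assms beta_gt_1 by (auto simp: A_def B_def)
  have "1 < \<beta> ^ (2 * a + 2 * b + 2)"
    using beta_gt_1 by (intro one_less_power) auto
  then have pos: "0 < \<beta> ^ 2 * A * B - 1"
    by (simp add: A_def B_def power_add power2_eq_square mult_ac)
  have a: "even_point a b = (\<beta> - 1) * (\<beta> * A * B - \<beta> * B + B - 1) / (\<beta> ^ 2 * A * B - 1)"
    and b: "even_point b a = (\<beta> - 1) * (\<beta> * A * B - \<beta> * A + A - 1) / (\<beta> ^ 2 * A * B - 1)"
    unfolding even_point_def A_def B_def power_add by (simp_all add: mult_ac)
  have "0 \<le> \<beta> * B * (A - 1) + (B - 1)"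
    using A AB beta_gt_1 by (intro add_nonneg_nonneg mult_nonneg_nonneg) auto
  then have "0 \<le> \<beta> * A * B - \<beta> * B + B - 1"
    by (simp add: algebra_simps)
  then show "0 \<le> even_point a b"
    unfolding a using pos beta_gt_1 by simp
  have "0 < (\<beta> - 1) * (B - A)"
    using AB beta_gt_1 by simp
  then have "\<beta> * A * B - \<beta> * B + B - 1 < \<beta> * A * B - \<beta> * A + A - 1"
    by (simp add: algebra_simps)
  then show "even_point a b < even_point b a"
    unfolding a b using pos beta_gt_1 by (intro divide_strict_right_mono mult_strict_left_mono) auto
  have "0 \<le> A * (2 - \<beta>)"
    using A beta_bounds by simp
  then have "(\<beta> - 1) * (\<beta> * A * B - \<beta> * A + A - 1) < (2 - \<beta>) * (\<beta> ^ 2 * A * B - 1)"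
    using beta_bounds by (simp add: power2_eq_square beta_simps)
  then show "even_point b a < 2 - \<beta>"
    unfolding b using pos by (simp add: divide_simps)
qed

text \<open>
  In the upper bound, the hypothesis \<open>b \<le> a + 2\<close> makes
  \<open>2 a + 2 b + 2 < 4 (a + 1) + 4\<close>, so that a first block of index \<open>a + 1\<close> would be too long for an
  orbit of this period. Once the first index is known to be \<open>a\<close>, its end point exceeds the one of
  the extremal orbit, the second block has to contain at least \<open>b\<close> words \<open>01\<close>, and the total time
  is used up.
\<close>
theorem S_beta_even:
  assumes "a < b" "b \<le> a + 2"
  shows "S_beta \<beta> (2 * a + 2 * b + 2) = even_point a b"
proof -
  let ?s = "even_point a b" and ?w = "even_point b a" and ?p = "2 * a + 2 * b + 2"
  note s0 = even_point_bounds(1)[OF assms(1)] and sw = even_point_bounds(2)[OF assms(1)]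
    and w = even_point_bounds(3)[OF assms(1)]
  have s: "?s < 2 - \<beta>" and w0: "0 \<le> ?w"
    using s0 sw w by auto
  have nonneg: "0 \<le> block a ?s" "0 \<le> block b ?w"
    using s0 w0 by (simp_all add: block_even_point)
  have split: "?p = (2 * b + 1) + (2 * a + 1)" by simp
  have comp: "(T ^^ ?p) z = (T ^^ (2 * b + 1)) ((T ^^ (2 * a + 1)) z)" for z
    unfolding split funpow_add[of "2 * b + 1"] by (simp only: comp_apply)
  have Ts: "(T ^^ (2 * a + 1)) ?s = ?w" and Tw: "(T ^^ (2 * b + 1)) ?w = ?s"
    using block_funpow[OF s0 s nonneg(1)] block_funpow[OF w0 w nonneg(2)]
    by (simp_all add: block_even_point)
  have cycle: "(T ^^ ?p) ?s = ?s"
    unfolding comp Ts Tw ..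
  have above: "?s < (T ^^ j) ?s" if j: "0 < j" "j < ?p" for j
  proof -
    consider "j < 2 * a + 1" | "j = 2 * a + 1"
      | i where "j = i + (2 * a + 1)" "0 < i" "i < 2 * b + 1"
      using j that(3)[of "j - (2 * a + 1)"] by (cases j "2 * a + 1" rule: linorder_cases) auto
    then show ?thesis
    proof cases
      case 1
      then show ?thesis
        using block_between[OF s0 s nonneg(1) \<open>0 < j\<close>] s by linarith
    next
      case 2
      then show ?thesis
        using Ts sw by simp
    next
      case (3 i)
      then have "(T ^^ j) ?s = (T ^^ i) ?w"
        by (metis Ts comp_apply funpow_add)
      then show ?thesis
        using block_between[OF w0 w nonneg(2) 3(2,3)] s by linarith
    qed
  qed
  show ?thesis
  proof (rule S_beta_eqI)
    show "0 \<le> ?s" "?s < 1" using s0 s beta_gt_1 by auto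
    show "has_smallest_period T ?s ?p" "\<And>n. ?s \<le> (T ^^ n) ?s"
      using cycle_above_base_point[OF cycle _ above] by auto
  next
    fix x assume x: "0 \<le> x" "x < 1" "has_smallest_period T x ?p" "\<And>n. x \<le> (T ^^ n) x"
    note less = least_point_less[OF x(1,2,4)]
    have per: "(T ^^ ?p) x = x"
      using x(3) by (simp add: has_smallest_period_def)
    show "x \<le> ?s"
    proof (rule ccontr)
      assume "\<not> x \<le> ?s"
      then have gt: "?s < x" by simp
      have y: "?w < block a x"
        using block_strict_mono[OF gt, of a] by (simp add: block_even_point)
      then have y0: "0 \<le> block a x"
        using w0 by linarith
      obtain k where k: "0 \<le> block k x" "block k x < 2 - \<beta>"
        using return_index[OF x(1) less per] by auto
      have "a \<le> k"
        by (rule block_index_le[OF less y0 k(2)])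
      moreover have "4 * k + 4 \<le> ?p"
        by (rule even_period_return_index[OF x(1) less x(3) _ _ x(4) k]) auto
      ultimately have "k = a"
        using assms(2) by linarith
      then have y1: "block a x < 2 - \<beta>"
        using k(2) by simp
      have z: "?s < block b (block a x)"
        using block_strict_mono[OF y, of b] by (simp add: block_even_point)
      then have "0 \<le> block b (block a x)"
        using s0 by linarith
      then have "block b (block a x) = (T ^^ ?p) x"
        unfolding comp block_funpow[OF x(1) less y0]
        by (rule block_funpow[OF y0 y1, symmetric])
      then have "x - ?s = block b (block a x) - block b (block a ?s)"
        using per by (simp add: block_even_point)
      then have "x - ?s = \<beta> ^ (2 * b + 1) * \<beta> ^ (2 * a + 1) * (x - ?s)"
        by (simp add: block_diff mult.assoc del: power_Suc)
      then have "\<beta> ^ ?p = 1"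
        using gt by (simp add: power_add mult_ac)
      moreover have "1 < \<beta> ^ ?p"
        using beta_gt_1 by (intro one_less_power) auto
      ultimately show False
        by simp
    qed
  qed simp
qed

text \<open>
  For period \<open>2\<close> the bound \<open>4 * k + 4 \<le> p\<close> already demands period at least \<open>4\<close>.
  The only candidate, the cycle of the digits \<open>01\<close>, would be the orbit of the fixed point
  \<open>\<beta> - 1\<close> of \<open>x \<mapsto> \<beta>\<^sup>2 x - 1\<close>, and \<open>T\<close> sends that point to \<open>0\<close>.
\<close>
theorem S_beta_2: "S_beta \<beta> 2 = 0"
proof -
  have False if t: "t \<in> period_levels \<beta> 2" for t
  proof -
    obtain x where x: "0 \<le> x" "x < 1" "has_smallest_period T x 2" "\<And>n. x \<le> (T ^^ n) x"
      by (rule period_level_least_point[OF t zero_less_numeral]) (rule that)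
    note less = least_point_less[OF x(1,2,4)]
    have per: "(T ^^ 2) x = x"
      using x(3) by (simp add: has_smallest_period_def)
    obtain k where k: "0 \<le> block k x" "block k x < 2 - \<beta>"
      by (rule return_index[OF x(1) less per zero_less_numeral])
    have "4 * k + 4 \<le> (2 :: nat)"
      by (rule even_period_return_index[OF x(1) less x(3) _ _ x(4) k]) simp_all
    then show False by simp
  qed
  then show ?thesis
    by (auto simp: S_beta_def)
qed

section \<open>Monotonicity and the limit\<close>

text \<open>
  The relative shortfall of the value for the even period \<open>2 n \<ge> 4\<close> from the limit \<open>2 - \<beta>\<close>. The
  extra \<open>\<beta>\<close> for odd \<open>n\<close> records that the two block indices then differ by \<open>2\<close> instead of \<open>1\<close>.
\<close>
definition even_defect :: "nat \<Rightarrow> real" where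
  "even_defect n = ((if even n then 1 else \<beta>) * \<beta> ^ n + (\<beta> - 1)) / (\<beta> ^ (2 * n) - 1)"

lemma odd_point_defect: "odd_point m = (2 - \<beta>) * (1 - (\<beta> - 1) / (\<beta> ^ (2 * m + 1) - 1))"
proof -
  have "1 < \<beta> ^ (2 * m + 1)"
    using beta_gt_1 by (intro one_less_power) auto
  then show ?thesis
    by (simp add: odd_point_def divide_simps) (simp add: beta_simps)
qed

text \<open>
  The two parities of \<open>n\<close> correspond to the pairs of indices \<open>(a, a + 1)\<close> with \<open>n = 2 a + 2\<close> and
  \<open>(a, a + 2)\<close> with \<open>n = 2 a + 3\<close>.
\<close>
lemma S_beta_even_defect:
  assumes "2 \<le> n"
  shows "S_beta \<beta> (2 * n) = (2 - \<beta>) * (1 - even_defect n)"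
proof -
  define R where "R = \<beta> ^ n"
  have "1 < R ^ 2"
    using beta_gt_1 assms by (auto simp: R_def simp flip: power_mult intro!: one_less_power)
  have R2: "\<beta> ^ (2 * n) = R * R"
    by (simp add: R_def mult_2 power_add)
  show ?thesis
  proof (cases "even n")
    case True
    define a where "a = (n - 2) div 2"
    have a: "n = 2 * a + 2"
      using True assms unfolding a_def by presburger
    have exps: "2 * a + 2 * (a + 1) + 2 = 2 * n"
      by (simp add: a)
    have "S_beta \<beta> (2 * n) = even_point a (a + 1)"
      using S_beta_even[of a "a + 1"] unfolding exps by simp
    also have "\<dots> = (\<beta> - 1) * ((\<beta> - 1) * R ^ 2 - \<beta> * R + R - 1) / (R ^ 2 - 1)"
    proof -
      have "\<beta> ^ (2 * a + 2 * (a + 1) + 2) = R ^ 2" "\<beta> ^ (2 * (a + 1) + 1) = \<beta> * R"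
          "\<beta> ^ (2 * (a + 1)) = R"
        by (simp_all add: R_def a power_add power2_eq_square mult_2)
      moreover have "R ^ 2 = \<beta> * \<beta> ^ (2 * a + 2 * (a + 1) + 1)"
        by (simp add: R_def a power_add power2_eq_square mult_2)
      then have "\<beta> ^ (2 * a + 2 * (a + 1) + 1) = (\<beta> - 1) * R ^ 2"
        by (simp add: beta_simps)
      ultimately show ?thesis
        by (simp only: even_point_def)
    qed
    also have "\<dots> = (2 - \<beta>) * (1 - even_defect n)"
      using True \<open>1 < R ^ 2\<close>
      by (simp add: even_defect_def R2 flip: R_def)
         (simp add: divide_simps power2_eq_square, simp add: beta_simps)
    finally show ?thesis .
  next
    case False
    define a where "a = (n - 3) div 2"
    have a: "n = 2 * a + 3"
      using False assms unfolding a_def by presburger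
    have exps: "2 * a + 2 * (a + 2) + 2 = 2 * n"
      by (simp add: a)
    have "S_beta \<beta> (2 * n) = even_point a (a + 2)"
      using S_beta_even[of a "a + 2"] unfolding exps by simp
    also have "\<dots> = (\<beta> - 1) * ((\<beta> - 1) * R ^ 2 - \<beta> ^ 2 * R + \<beta> * R - 1) / (R ^ 2 - 1)"
    proof -
      have "\<beta> ^ (2 * a + 2 * (a + 2) + 2) = R ^ 2" "\<beta> ^ (2 * (a + 2) + 1) = \<beta> ^ 2 * R"
          "\<beta> ^ (2 * (a + 2)) = \<beta> * R"
        by (simp_all add: R_def a power_add power2_eq_square mult_2 numeral_3_eq_3)
      moreover have "R ^ 2 = \<beta> * \<beta> ^ (2 * a + 2 * (a + 2) + 1)"
        by (simp add: R_def a power_add power2_eq_square mult_2 numeral_3_eq_3)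
      then have "\<beta> ^ (2 * a + 2 * (a + 2) + 1) = (\<beta> - 1) * R ^ 2"
        by (simp add: beta_simps)
      ultimately show ?thesis
        by (simp only: even_point_def)
    qed
    also have "\<dots> = (2 - \<beta>) * (1 - even_defect n)"
      using False \<open>1 < R ^ 2\<close>
      by (simp add: even_defect_def R2 flip: R_def)
         (simp add: divide_simps power2_eq_square, simp add: beta_simps)
    finally show ?thesis .
  qed
qed

lemma even_defect_decreasing:
  assumes "1 \<le> n"
  shows "even_defect (Suc n) < even_defect n"
proof -
  define R where "R = \<beta> ^ n"
  have R: "1 < R"
    using beta_gt_1 assms by (auto simp: R_def intro!: one_less_power)
  have R2: "\<beta> ^ (2 * n) = R * R" "\<beta> ^ (2 * Suc n) = (\<beta> * R) * (\<beta> * R)"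
    by (simp_all add: R_def mult_2 power_add)
  have "R < \<beta> * R"
    using R beta_gt_1 by simp
  then have pos: "0 < R * R - 1" "R * R < (\<beta> * R) * (\<beta> * R)"
    using R less_1_mult[of R R] mult_strict_mono'[of R "\<beta> * R" R "\<beta> * R"] by auto
  show ?thesis
  proof (cases "even n")
    case True
    have "0 < \<beta> * R + (\<beta> - 1) * (\<beta> * (R * R))"
      using R beta_gt_1 by (intro add_pos_pos mult_pos_pos) auto
    then have "(\<beta> * (\<beta> * R) + (\<beta> - 1)) * (R * R - 1)
               < (R + (\<beta> - 1)) * ((\<beta> * R) * (\<beta> * R) - 1)"
      by (simp add: beta_simps)
    then show ?thesis
      using True pos unfolding even_defect_def R2 power_Suc R_def[symmetric]
      by (simp add: divide_less_eq less_divide_eq divide_simps)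
  next
    case False
    have "(\<beta> * R + (\<beta> - 1)) / ((\<beta> * R) * (\<beta> * R) - 1) < (\<beta> * R + (\<beta> - 1)) / (R * R - 1)"
      by (intro divide_strict_left_mono mult_pos_pos add_pos_pos) (use pos R beta_gt_1 in linarith)+
    then show ?thesis
      using False unfolding even_defect_def R2 power_Suc R_def[symmetric] by simp
  qed
qed

text \<open>
  The upper bound \<open>1\<close> makes the value for period \<open>4\<close> exceed the value \<open>0\<close> for period \<open>2\<close>; the
  geometric bound gives the limit. Both rest on \<open>\<beta> ^ n \<ge> \<beta>\<^sup>2 > 13/5\<close>.
\<close>
lemma even_defect_bounds:
  assumes "2 \<le> n"
  shows "0 < even_defect n" "even_defect n \<le> 4 * (1 / \<beta>) ^ n" "even_defect n < 1"
proof -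
  define R where "R = \<beta> ^ n"
  have R2: "\<beta> ^ (2 * n) = R * R"
    by (simp add: R_def mult_2 power_add)
  have "\<beta> ^ 2 \<le> R"
    unfolding R_def using assms beta_gt_1 by (intro power_increasing) auto
  then have R: "13 / 5 < R"
    using beta_bounds by (simp add: beta_square)
  then have RR: "13 / 5 * R < R * R"
    by (intro mult_strict_right_mono) auto
  then have RR1: "1 < R * R"
    using R by linarith
  have "0 < even_defect n \<and> even_defect n \<le> (\<beta> * R + (\<beta> - 1)) / (R * R - 1)"
    unfolding even_defect_def R2 R_def[symmetric] using R RR1 beta_gt_1
    by (auto intro!: divide_pos_pos add_pos_pos divide_right_mono less_imp_le[OF RR1])
  moreover have "\<beta> * R < 81 / 50 * R"
    using R beta_bounds by (intro mult_strict_right_mono) auto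
  moreover from this have "\<beta> * R + (\<beta> - 1) < 1 * (R * R - 1)"
    using R RR beta_bounds by argo
  moreover have "(\<beta> * R + (\<beta> - 1)) / (R * R - 1) \<le> 4 / R"
  proof -
    have "\<beta> * (R * R) < 81 / 50 * (R * R)" "(\<beta> - 1) * R < 31 / 50 * R"
      using R beta_bounds by (intro mult_strict_right_mono; simp)+
    then have "\<beta> * (R * R) + (\<beta> - 1) * R \<le> 4 * (R * R - 1)"
      using R RR by argo
    then have "R * (\<beta> * R + (\<beta> - 1)) \<le> 4 * (R * R - 1)"
      by (simp add: algebra_simps)
    then show ?thesis
      using R RR1 by (simp add: divide_simps mult.commute)
  qed
  ultimately show "0 < even_defect n" "even_defect n \<le> 4 * (1 / \<beta>) ^ n" "even_defect n < 1"
    using RR1 by (auto simp: R_def[symmetric] power_divide divide_less_eq intro: le_less_trans)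
qed

lemma S_beta_odd_strict_mono: "strict_mono_on {p. odd p} (S_beta \<beta>)"
proof (rule strict_mono_onI)
  fix p q :: nat assume "p \<in> {p. odd p}" "q \<in> {p. odd p}" "p < q"
  then obtain m n where mn: "p = 2 * m + 1" "q = 2 * n + 1" "m < n"
    by (auto elim!: oddE)
  have "1 < \<beta> ^ (2 * m + 1)"
    using beta_gt_1 by (intro one_less_power) auto
  moreover have "\<beta> ^ (2 * m + 1) < \<beta> ^ (2 * n + 1)"
    using mn beta_gt_1 by (intro power_strict_increasing) auto
  ultimately have "(\<beta> - 1) / (\<beta> ^ (2 * n + 1) - 1) < (\<beta> - 1) / (\<beta> ^ (2 * m + 1) - 1)"
    by (intro divide_strict_left_mono mult_pos_pos) (use beta_gt_1 in linarith)+
  then show "S_beta \<beta> p < S_beta \<beta> q"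
    using beta_bounds unfolding mn S_beta_odd odd_point_defect
    by (intro mult_strict_left_mono) auto
qed

lemma S_beta_even_strict_mono: "strict_mono_on {p. even p \<and> p > 0} (S_beta \<beta>)"
proof -
  have mono: "strict_mono (\<lambda>n. S_beta \<beta> (2 * Suc n))"
  proof (rule strict_mono_Suc_iff[THEN iffD2], rule allI)
    fix n
    show "S_beta \<beta> (2 * Suc n) < S_beta \<beta> (2 * Suc (Suc n))"
    proof (cases "n = 0")
      case True
      then show ?thesis
        using S_beta_even_defect[of 2] even_defect_bounds(3)[of 2] S_beta_2 beta_bounds
        by (simp add: numeral_2_eq_2)
    next
      case False
      then show ?thesis
        using S_beta_even_defect[of "Suc n"] S_beta_even_defect[of "Suc (Suc n)"]
          even_defect_decreasing[of "Suc n"] beta_bounds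
        by (simp add: mult_strict_left_mono del: mult_Suc_right)
    qed
  qed
  show ?thesis
  proof (rule strict_mono_onI)
    fix p q :: nat assume pq: "p \<in> {p. even p \<and> p > 0}" "q \<in> {p. even p \<and> p > 0}" "p < q"
    define m n where "m = p div 2 - 1" and "n = q div 2 - 1"
    have "p = 2 * Suc m" "q = 2 * Suc n"
      using pq by (auto simp: m_def n_def elim!: evenE)
    then show "S_beta \<beta> p < S_beta \<beta> q"
      using strict_monoD[OF mono, of m n] \<open>p < q\<close> by simp
  qed
qed

text \<open>
  A single bound, by a geometric sequence in \<open>p div 2\<close>, serves both parities.
\<close>
lemma S_beta_tendsto: "S_beta \<beta> \<longlonglongrightarrow> 2 - \<beta>"
proof -
  have half: "filterlim (\<lambda>p::nat. p div 2) at_top sequentially"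
    unfolding filterlim_at_top
  proof
    fix Z :: nat
    show "\<forall>\<^sub>F p in sequentially. Z \<le> p div 2"
      using eventually_ge_at_top[of "2 * Z"] by eventually_elim linarith
  qed
  have "(\<lambda>p. (1 / \<beta>) ^ (p div 2)) \<longlonglongrightarrow> 0"
    using beta_gt_1 filterlim_compose[OF LIMSEQ_realpow_zero half] by simp
  then have lim: "(\<lambda>p. 4 * (1 / \<beta>) ^ (p div 2)) \<longlonglongrightarrow> 0"
    by (rule tendsto_mult_right_zero)
  have bound: "\<bar>S_beta \<beta> p - (2 - \<beta>)\<bar> \<le> 4 * (1 / \<beta>) ^ (p div 2)" if "4 \<le> p" for p
  proof -
    obtain d where d: "S_beta \<beta> p = (2 - \<beta>) * (1 - d)" "0 \<le> d" "d \<le> 4 * (1 / \<beta>) ^ (p div 2)"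
    proof (cases "even p")
      case True
      have n: "2 \<le> p div 2"
        using \<open>4 \<le> p\<close> by linarith
      show thesis
        using that[of "even_defect (p div 2)"] S_beta_even_defect[OF n] even_defect_bounds[OF n] True
        by simp
    next
      case False
      then obtain m where m: "p = 2 * m + 1"
        by (auto elim: oddE)
      define R where "R = \<beta> ^ m"
      have R: "1 \<le> R" "R \<le> R * R"
        using one_le_beta_power[of m] by (auto simp: R_def)
      have pow: "\<beta> ^ (2 * m + 1) = \<beta> * (R * R)"
        by (simp add: R_def mult_2 power_add)
      have "8 / 5 * (R * R) \<le> \<beta> * (R * R)" "(\<beta> - 1) * R \<le> 1 * R"
        using R beta_bounds by (intro mult_right_mono; simp)+
      then have "(\<beta> - 1) * R \<le> 4 * (\<beta> * (R * R) - 1)" "0 < \<beta> * (R * R) - 1"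
        using R by argo+
      then have "(\<beta> - 1) / (\<beta> * (R * R) - 1) \<le> 4 / R"
        using R by (simp add: divide_simps mult.commute)
      then show thesis
        using that[of "(\<beta> - 1) / (\<beta> * (R * R) - 1)"] S_beta_odd[of m] odd_point_defect[of m]
          beta_gt_1 \<open>0 < \<beta> * (R * R) - 1\<close>
        unfolding m pow by (simp add: R_def power_divide)
    qed
    have "\<bar>S_beta \<beta> p - (2 - \<beta>)\<bar> = (2 - \<beta>) * d"
    proof -
      have "S_beta \<beta> p - (2 - \<beta>) = - ((2 - \<beta>) * d)"
        by (simp add: d(1) algebra_simps)
      moreover have "0 \<le> (2 - \<beta>) * d"
        using d(2) beta_bounds by (intro mult_nonneg_nonneg) auto
      ultimately show ?thesis
        by (simp only: abs_minus_cancel abs_of_nonneg)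
    qed
    also have "\<dots> \<le> 1 * d"
      using d(2) beta_gt_1 by (intro mult_right_mono) auto
    finally show ?thesis
      using d(3) by simp
  qed
  have "(\<lambda>p. S_beta \<beta> p - (2 - \<beta>)) \<longlonglongrightarrow> 0"
    by (rule Lim_null_comparison[OF _ lim])
       (use bound in \<open>auto intro!: eventually_sequentiallyI[of 4]\<close>)
  then show ?thesis
    by (simp add: LIM_zero_iff)
qed

lemma beta_powers: "\<beta> ^ 3 = 2 * \<beta> + 1" "\<beta> ^ 4 = 3 * \<beta> + 2" "\<beta> ^ 6 = 8 * \<beta> + 5"
  by (simp_all add: eval_nat_numeral beta_simps)

end

text \<open>
  The even formulas belong to the index pairs \<open>(m - 1, m + 1)\<close> and \<open>(m, m + 1)\<close>, the values for the
  periods \<open>4\<close> and \<open>6\<close> to the pairs \<open>(0, 1)\<close> and \<open>(0, 2)\<close>.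
\<close>
theorem corollary4p4:
  fixes \<beta> :: real
  assumes golden: "\<beta> = (1 + sqrt 5) / 2"
  shows
   "(S_beta \<beta> 4 = 1 / (\<beta> ^ 4 - 1)) \<and>
    (\<bar>1 / (\<beta> ^ 4 - 1) - 0.1708\<bar> < 0.00005) \<and>
    (S_beta \<beta> 6 = (\<beta> ^ 2 + 1) / (\<beta> ^ 6 - 1)) \<and>
    (\<bar>(\<beta> ^ 2 + 1) / (\<beta> ^ 6 - 1) - 0.2135\<bar> < 0.00005) \<and>
    (\<forall>m::nat. S_beta \<beta> (2 * m + 1) =
           (1 - \<beta> ^ (2 * m)) / ((\<beta> ^ (2 * m + 1) - 1) * (1 - \<beta> ^ 2))) \<and>
    (\<forall>m::nat. m \<ge> 2 \<longrightarrow> S_beta \<beta> (4 * m + 2) =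
           (1 + \<beta> ^ (2 * m + 3) - \<beta> ^ (2 * m + 2) - \<beta> ^ (4 * m + 1)) /
           ((\<beta> ^ (4 * m + 2) - 1) * (1 - \<beta> ^ 2))) \<and>
    (\<forall>m::nat. m \<ge> 1 \<longrightarrow> S_beta \<beta> (4 * m + 4) =
           (1 + \<beta> ^ (2 * m + 3) - \<beta> ^ (2 * m + 2) - \<beta> ^ (4 * m + 3)) /
           ((\<beta> ^ (4 * m + 4) - 1) * (1 - \<beta> ^ 2))) \<and>
    (strict_mono_on {p. odd p} (S_beta \<beta>)) \<and>
    (strict_mono_on {p. even p \<and> p > 0} (S_beta \<beta>)) \<and>
    (S_beta \<beta> \<longlonglongrightarrow> 1 / (\<beta> ^ 3 - \<beta>)) \<and>
    (\<bar>1 / (\<beta> ^ 3 - \<beta>) - 0.38212\<bar> < 0.0002)"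
proof -
  interpret golden_mean \<beta>
    by unfold_locales (rule golden)
  \<comment> \<open>the stated fractions have the denominator \<open>1 - \<beta>\<^sup>2 = - \<beta>\<close> where the extremal points have
     the factor \<open>\<beta> - 1 = 1/\<beta>\<close>\<close>
  have fraction: "(\<beta> - 1) * u / v = (- u) / (v * (1 - \<beta> ^ 2))" for u v
  proof -
    have "(- u) / (v * (1 - \<beta> ^ 2)) = u / v / \<beta>"
      by (simp add: beta_square)
    also have "\<dots> = (\<beta> - 1) * (u / v)"
      using beta_gt_1 by (simp add: divide_eq_eq) (simp add: beta_simps)
    finally show ?thesis by simp
  qed
  have limit: "1 / (\<beta> ^ 3 - \<beta>) = 2 - \<beta>"
    using beta_gt_1 by (simp add: beta_powers divide_eq_eq) (simp add: beta_simps)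
  have "S_beta \<beta> 4 = 1 / (\<beta> ^ 4 - 1)"
  proof -
    have "S_beta \<beta> 4 = even_point 0 1"
      using S_beta_even[of 0 1] by (simp add: eval_nat_numeral)
    also have "\<dots> = 1 / (\<beta> ^ 4 - 1)"
    proof -
      have "(\<beta> - 1) * (\<beta> ^ 2 - 1) = 1"
        by (simp add: beta_square beta_simps)
      then show ?thesis
        by (simp add: even_point_def eval_nat_numeral)
    qed
    finally show ?thesis .
  qed
  moreover have "S_beta \<beta> 6 = (\<beta> ^ 2 + 1) / (\<beta> ^ 6 - 1)"
  proof -
    have "S_beta \<beta> 6 = even_point 0 2"
      using S_beta_even[of 0 2] by simp
    also have "\<dots> = (\<beta> ^ 2 + 1) / (\<beta> ^ 6 - 1)"
      by (simp add: even_point_def beta_powers beta_square) (simp add: beta_simps)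
    finally show ?thesis .
  qed
  moreover have "S_beta \<beta> (2 * m + 1) =
           (1 - \<beta> ^ (2 * m)) / ((\<beta> ^ (2 * m + 1) - 1) * (1 - \<beta> ^ 2))" for m
    by (simp only: S_beta_odd odd_point_def fraction minus_diff_eq)
  moreover have "S_beta \<beta> (4 * m + 2) =
           (1 + \<beta> ^ (2 * m + 3) - \<beta> ^ (2 * m + 2) - \<beta> ^ (4 * m + 1)) /
           ((\<beta> ^ (4 * m + 2) - 1) * (1 - \<beta> ^ 2))" if "2 \<le> m" for m
  proof -
    obtain a where a: "m = a + 1"
      using \<open>2 \<le> m\<close> by (metis add.commute add_leD1 le_add_diff_inverse one_add_one)
    have exps: "2 * a + 2 * (a + 2) + 2 = 4 * m + 2" "2 * a + 2 * (a + 2) + 1 = 4 * m + 1"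
        "2 * (a + 2) + 1 = 2 * m + 3" "2 * (a + 2) = 2 * m + 2"
      by (simp_all add: a)
    have "S_beta \<beta> (4 * m + 2) = even_point a (a + 2)"
      unfolding exps(1)[symmetric] by (rule S_beta_even) auto
    then show ?thesis
      unfolding exps[symmetric] even_point_def fraction by (simp add: algebra_simps)
  qed
  moreover have "S_beta \<beta> (4 * m + 4) =
           (1 + \<beta> ^ (2 * m + 3) - \<beta> ^ (2 * m + 2) - \<beta> ^ (4 * m + 3)) /
           ((\<beta> ^ (4 * m + 4) - 1) * (1 - \<beta> ^ 2))" for m
  proof -
    have exps: "2 * m + 2 * (m + 1) + 2 = 4 * m + 4" "2 * m + 2 * (m + 1) + 1 = 4 * m + 3"
        "2 * (m + 1) + 1 = 2 * m + 3" "2 * (m + 1) = 2 * m + 2"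
      by simp_all
    have "S_beta \<beta> (4 * m + 4) = even_point m (m + 1)"
      unfolding exps(1)[symmetric] by (rule S_beta_even) auto
    then show ?thesis
      unfolding exps[symmetric] even_point_def fraction by (simp add: algebra_simps)
  qed
  moreover have "S_beta \<beta> \<longlonglongrightarrow> 1 / (\<beta> ^ 3 - \<beta>)"
    using S_beta_tendsto by (simp only: limit)
  moreover have "\<bar>1 / (\<beta> ^ 4 - 1) - 0.1708\<bar> < 0.00005"
    unfolding beta_powers abs_less_iff using beta_bounds by (simp add: field_simps)
  moreover have "\<bar>(\<beta> ^ 2 + 1) / (\<beta> ^ 6 - 1) - 0.2135\<bar> < 0.00005"
    unfolding beta_powers beta_square abs_less_iff using beta_bounds by (simp add: field_simps)
  moreover have "\<bar>1 / (\<beta> ^ 3 - \<beta>) - 0.38212\<bar> < 0.0002"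
    unfolding limit abs_less_iff using beta_bounds by simp
  ultimately show ?thesis
    using S_beta_odd_strict_mono S_beta_even_strict_mono by blast
qed

end
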